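(* For each $j\ge0$, the map $\omega_j:\mathcal{A}\times\mathcal{A}\to\mathbb{C}$, $\omega_j(X,Y)=\langle e_j,[X,Y]e_j\rangle$, is a continuous antisymmetric Chevalley–Eilenberg $2$-cocycle; that is, for all $X,Y,Z\in\mathcal{A}$: (1) $\omega_j(X,Y)=-\omega_j(Y,X)$; (2) $d\omega_j(X,Y,Z):=\omega_j([X,Y],Z)+\omega_j([Y,Z],X)+\omega_j([Z,X],Y)=0$; (3) $|\omega_j(X,Y)|\le\|[X,Y]\|\le2\|X\|\,\|Y\|$.
   Context: Let $(e_n)_{n\ge 0}$ be the canonical orthonormal basis of $\ell^2(\mathbb{Z}_{\ge 0})$ (inner product linear in the second argument). $U$ is the forward unilateral shift, $Ue_n=e_{n+1}$, and $Ef=\langle e_0,f\rangle e_0$. $\mathcal{A}=\mathrm{span}\{U^aE(U^* )^b,\ U^n: a,b,n\ge0\}$ (finite complex linear combinations), a Lie algebra under $[X,Y]=XY-YX$, equipped with the operator norm $\|\cdot\|$. *)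

theory Defs
  imports "HOL-Analysis.Analysis"
begin

section \<open>The complex Hilbert space of square-summable sequences\<close>

definition square_summable :: "(nat \<Rightarrow> complex) \<Rightarrow> bool" where
  "square_summable f \<longleftrightarrow> summable (\<lambda>n. (cmod (f n))\<^sup>2)"

lemma square_summable_zero: "square_summable (\<lambda>_. 0)"
  by (simp add: square_summable_def)

lemma square_summable_scale:
  assumes "square_summable f"
  shows "square_summable (\<lambda>n. c * f n)"
  using summable_mult[of _ "(cmod c)\<^sup>2"] assms
  by (simp add: square_summable_def norm_mult power_mult_distrib)

lemma square_summable_add:
  assumes "square_summable f" "square_summable g"
  shows "square_summable (\<lambda>n. f n + g n)"
  unfolding square_summable_def
proof (rule summable_comparison_test)
  show "summable (\<lambda>n. 2 * ((cmod (f n))\<^sup>2 + (cmod (g n))\<^sup>2))"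
    using assms unfolding square_summable_def by (intro summable_mult summable_add)
  have "(cmod (f n + g n))\<^sup>2 \<le> 2 * ((cmod (f n))\<^sup>2 + (cmod (g n))\<^sup>2)" for n
  proof -
    have "(cmod (f n + g n))\<^sup>2 \<le> (cmod (f n) + cmod (g n))\<^sup>2"
      by (intro power_mono norm_triangle_ineq) simp
    also have "\<dots> \<le> 2 * ((cmod (f n))\<^sup>2 + (cmod (g n))\<^sup>2)"
      using sum_squares_bound[of "cmod (f n)" "cmod (g n)"] by (simp add: power2_sum)
    finally show ?thesis .
  qed
  then show "\<exists>N. \<forall>n\<ge>N. norm ((cmod (f n + g n))\<^sup>2) \<le> 2 * ((cmod (f n))\<^sup>2 + (cmod (g n))\<^sup>2)"
    by simp
qed

lemma summable_cnj_mult: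
  assumes "square_summable f" "square_summable g"
  shows "summable (\<lambda>n. cnj (f n) * g n)"
proof (rule summable_comparison_test)
  show "summable (\<lambda>n. (cmod (f n))\<^sup>2 + (cmod (g n))\<^sup>2)"
    using assms unfolding square_summable_def by (intro summable_add)
  have "cmod (f n) * cmod (g n) \<le> (cmod (f n))\<^sup>2 + (cmod (g n))\<^sup>2" for n
    using sum_squares_bound[of "cmod (f n)" "cmod (g n)"]
      mult_nonneg_nonneg[OF norm_ge_zero[of "f n"] norm_ge_zero[of "g n"]]
    unfolding mult.assoc by linarith
  then show "\<exists>N. \<forall>n\<ge>N. norm (cnj (f n) * g n) \<le> (cmod (f n))\<^sup>2 + (cmod (g n))\<^sup>2"
    by (simp add: norm_mult)
qed

typedef ell2 = "{f. square_summable f}"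
  morphisms coord Abs_ell2
  using square_summable_zero by blast

lemma coord_Abs: "square_summable f \<Longrightarrow> coord (Abs_ell2 f) = f"
  by (simp add: Abs_ell2_inverse)

lemma square_summable_coord: "square_summable (coord x)"
  using coord by blast

lemma ell2_eqI: "(\<And>n. coord x n = coord y n) \<Longrightarrow> x = y"
  by (simp add: coord_inject[symmetric] ext)

definition scaleC :: "complex \<Rightarrow> ell2 \<Rightarrow> ell2" (infixr "*\<^sub>C" 75) where
  "c *\<^sub>C x = Abs_ell2 (\<lambda>n. c * coord x n)"

definition cinner :: "ell2 \<Rightarrow> ell2 \<Rightarrow> complex" where
  "cinner x y = (\<Sum>n. cnj (coord x n) * coord y n)"

lemma coord_scaleC: "coord (c *\<^sub>C x) n = c * coord x n"
  by (simp add: scaleC_def coord_Abs square_summable_scale square_summable_coord)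

lemma summable_cinner: "summable (\<lambda>n. cnj (coord x n) * coord y n)"
  by (intro summable_cnj_mult square_summable_coord)

text \<open>The underlying real inner product is the real part of the complex one; it has the same
  norm, \<open>norm x = sqrt (\<Sum>n. (cmod (coord x n))\<^sup>2)\<close> (lemma \<open>norm_ell2\<close>).\<close>

instantiation ell2 :: real_inner
begin

definition zero_ell2 :: ell2 where
  "zero_ell2 = Abs_ell2 (\<lambda>_. 0)"

definition plus_ell2 :: "ell2 \<Rightarrow> ell2 \<Rightarrow> ell2" where
  "plus_ell2 x y = Abs_ell2 (\<lambda>n. coord x n + coord y n)"

definition scaleR_ell2 :: "real \<Rightarrow> ell2 \<Rightarrow> ell2" where
  "scaleR_ell2 r x = complex_of_real r *\<^sub>C x"

definition uminus_ell2 :: "ell2 \<Rightarrow> ell2" where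
  "uminus_ell2 x = (- 1) *\<^sub>C x"

definition minus_ell2 :: "ell2 \<Rightarrow> ell2 \<Rightarrow> ell2" where
  "minus_ell2 x y = x + (- y)"

definition inner_ell2 :: "ell2 \<Rightarrow> ell2 \<Rightarrow> real" where
  "inner_ell2 x y = Re (cinner x y)"

definition norm_ell2 :: "ell2 \<Rightarrow> real" where
  "norm_ell2 x = sqrt (inner x x)"

definition sgn_ell2 :: "ell2 \<Rightarrow> ell2" where
  "sgn_ell2 x = scaleR (inverse (norm x)) x"

definition dist_ell2 :: "ell2 \<Rightarrow> ell2 \<Rightarrow> real" where
  "dist_ell2 x y = norm (x - y)"

definition uniformity_ell2 :: "(ell2 \<times> ell2) filter" where
  "uniformity_ell2 = (INF e\<in>{0<..}. principal {(x, y). dist x y < e})"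

definition open_ell2 :: "ell2 set \<Rightarrow> bool" where
  "open_ell2 S \<longleftrightarrow> (\<forall>x\<in>S. \<forall>\<^sub>F (x', y) in uniformity. x' = x \<longrightarrow> y \<in> S)"

lemma coord_zero: "coord 0 n = 0"
  by (simp add: zero_ell2_def coord_Abs square_summable_zero)

lemma coord_plus: "coord (x + y) n = coord x n + coord y n"
  by (simp add: plus_ell2_def coord_Abs square_summable_add square_summable_coord)

lemma coord_scaleR: "coord (r *\<^sub>R x) n = complex_of_real r * coord x n"
  by (simp add: scaleR_ell2_def coord_scaleC)

lemma coord_uminus: "coord (- x) n = - coord x n"
  by (simp add: uminus_ell2_def coord_scaleC)

lemma coord_minus: "coord (x - y) n = coord x n - coord y n"
  by (simp add: minus_ell2_def coord_plus coord_uminus)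

lemma cinner_self_sums: "(\<lambda>n. (cmod (coord x n))\<^sup>2) sums Re (cinner x x)"
proof -
  have "(\<lambda>n. Re (cnj (coord x n) * coord x n)) sums Re (cinner x x)"
    unfolding cinner_def by (intro sums_Re summable_sums summable_cinner)
  moreover have "Re (cnj (coord x n) * coord x n) = (cmod (coord x n))\<^sup>2" for n
    by (metis Re_complex_of_real complex_norm_square mult.commute)
  ultimately show ?thesis by simp
qed

lemma cinner_commute: "cinner x y = cnj (cinner y x)"
proof -
  have "(\<lambda>n. cnj (cnj (coord y n) * coord x n)) sums cnj (cinner y x)"
    unfolding cinner_def sums_cnj by (intro summable_sums summable_cinner)
  then have "(\<lambda>n. cnj (coord x n) * coord y n) sums cnj (cinner y x)"
    by (simp add: mult.commute)
  then show ?thesis unfolding cinner_def[of x y] by (rule sums_unique[symmetric])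
qed

lemma cinner_add_left: "cinner (x + y) z = cinner x z + cinner y z"
  unfolding cinner_def coord_plus
  by (simp add: distrib_right suminf_add[symmetric] summable_cinner)

lemma cinner_add_right: "cinner z (x + y) = cinner z x + cinner z y"
  unfolding cinner_def coord_plus
  by (simp add: distrib_left suminf_add[symmetric] summable_cinner)

lemma cinner_scaleC_right: "cinner z (c *\<^sub>C x) = c * cinner z x"
  unfolding cinner_def coord_scaleC suminf_mult[OF summable_cinner, symmetric]
  by (simp add: mult.left_commute)

lemma cinner_scaleC_left: "cinner (c *\<^sub>C x) z = cnj c * cinner x z"
  unfolding cinner_def coord_scaleC suminf_mult[OF summable_cinner, symmetric]
  by (simp add: mult.assoc)

instance
proof
  fix x y z :: ell2 and r s :: real
  show "x + y + z = x + (y + z)" "x + y = y + x" "0 + x = x" "- x + x = 0" "x - y = x + - y"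
    by (auto intro!: ell2_eqI simp: coord_plus coord_zero coord_uminus coord_minus)
  show "r *\<^sub>R (x + y) = r *\<^sub>R x + r *\<^sub>R y" "(r + s) *\<^sub>R x = r *\<^sub>R x + s *\<^sub>R x"
    "r *\<^sub>R s *\<^sub>R x = (r * s) *\<^sub>R x" "1 *\<^sub>R x = x"
    by (auto intro!: ell2_eqI simp: coord_plus coord_scaleR algebra_simps)
  show "sgn x = scaleR (inverse (norm x)) x" "dist x y = norm (x - y)" "norm x = sqrt (inner x x)"
    by (simp_all add: sgn_ell2_def dist_ell2_def norm_ell2_def)
  show "(uniformity :: (ell2 \<times> ell2) filter) = (INF e\<in>{0<..}. principal {(x, y). dist x y < e})"
    by (rule uniformity_ell2_def)
  show "open S \<longleftrightarrow> (\<forall>x\<in>S. \<forall>\<^sub>F (x', y) in uniformity. x' = x \<longrightarrow> y \<in> S)" for S :: "ell2 set"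
    by (rule open_ell2_def)
  show "inner x y = inner y x"
    unfolding inner_ell2_def by (subst cinner_commute) simp
  show "inner (x + y) z = inner x z + inner y z"
    by (simp add: inner_ell2_def cinner_add_left)
  show "inner (r *\<^sub>R x) y = r * inner x y"
    by (simp add: inner_ell2_def scaleR_ell2_def cinner_scaleC_left)
  show "0 \<le> inner x x"
    unfolding inner_ell2_def by (rule sums_le[OF _ sums_zero cinner_self_sums]) simp
  show "inner x x = 0 \<longleftrightarrow> x = 0"
  proof
    assume "inner x x = 0"
    then have "(\<lambda>n. (cmod (coord x n))\<^sup>2) sums 0"
      using cinner_self_sums[of x] by (simp add: inner_ell2_def)
    then have "(cmod (coord x n))\<^sup>2 = 0" for n
      using suminf_eq_zero_iff[of "\<lambda>n. (cmod (coord x n))\<^sup>2"] by (auto simp: sums_iff)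
    then show "x = 0" by (intro ell2_eqI) (simp add: coord_zero)
  qed (simp add: inner_ell2_def cinner_def coord_zero)
qed

end

lemma norm_ell2: "norm x = sqrt (\<Sum>n. (cmod (coord x n))\<^sup>2)"
  using sums_unique[OF cinner_self_sums[of x]] by (simp add: norm_ell2_def inner_ell2_def)

lemma norm_scaleC: "norm (c *\<^sub>C x) = cmod c * norm x"
proof -
  have "summable (\<lambda>n. (cmod (coord x n))\<^sup>2)" using cinner_self_sums sums_summable by blast
  then show ?thesis
    by (simp add: norm_ell2 coord_scaleC norm_mult power_mult_distrib suminf_mult real_sqrt_mult)
qed

lemma cinner_ext: "(\<And>z. cinner x z = cinner y z) \<Longrightarrow> x = y"
proof -
  assume "\<And>z. cinner x z = cinner y z"
  then have "inner (x - y) (x - y) = 0"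
    by (simp add: inner_diff_left) (simp add: inner_ell2_def)
  then show "x = y" by simp
qed

lemma cinner_Cauchy_Schwarz: "cmod (cinner x y) \<le> norm x * norm y"
proof (cases "cinner x y = 0")
  case False
  define c where "c = cnj (cinner x y) / cmod (cinner x y)"
  have c: "cmod c = 1" using False by (simp add: c_def norm_divide)
  have "c * cinner x y = complex_of_real (cmod (cinner x y))"
    using False complex_norm_square[of "cinner x y"]
    by (simp add: c_def power2_eq_square mult.commute divide_eq_eq)
  then have "cmod (cinner x y) = inner x (c *\<^sub>C y)"
    by (simp add: inner_ell2_def cinner_scaleC_right)
  also have "\<dots> \<le> norm x * norm (c *\<^sub>C y)" by (rule norm_cauchy_schwarz)
  finally show ?thesis by (simp add: norm_scaleC c)
qed simp

definition ket :: "nat \<Rightarrow> ell2" where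
  "ket n = Abs_ell2 (\<lambda>k. if k = n then 1 else 0)"

lemma coord_ket: "coord (ket n) k = (if k = n then 1 else 0)"
proof -
  have "square_summable (\<lambda>k. if k = n then 1 else 0)"
    unfolding square_summable_def by (rule summable_finite[of "{n}"]) auto
  then show ?thesis by (simp add: ket_def coord_Abs)
qed

lemma cinner_ket: "cinner (ket n) x = coord x n"
proof -
  have "cinner (ket n) x = (\<Sum>k\<in>{n}. cnj (coord (ket n) k) * coord x k)"
    unfolding cinner_def by (rule suminf_finite) (auto simp: coord_ket)
  then show ?thesis by (simp add: coord_ket)
qed

lemma norm_ket: "norm (ket n) = 1"
  by (simp add: norm_ell2_def inner_ell2_def cinner_ket coord_ket)


section \<open>Operators\<close>

text \<open>Operators live in the library type of bounded real-linear maps, whose norm is the operator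
  norm.  All operators of interest are complex-linear (lemma \<open>shift_algebra_clinear\<close>).\<close>

type_synonym op = "ell2 \<Rightarrow>\<^sub>L ell2"

definition clinear_op :: "op \<Rightarrow> bool" where
  "clinear_op T \<longleftrightarrow> (\<forall>c x. T (c *\<^sub>C x) = c *\<^sub>C T x)"

lemma bounded_linear_scaleC: "bounded_linear ((*\<^sub>C) c)"
  by (rule bounded_linear_intro[where K = "cmod c"])
     (auto intro!: ell2_eqI simp: coord_plus coord_scaleC coord_scaleR norm_scaleC algebra_simps)

definition scaleC_op :: "complex \<Rightarrow> op \<Rightarrow> op" (infixr "*\<^sub>O" 75) where
  "c *\<^sub>O T = Blinfun ((*\<^sub>C) c) o\<^sub>L T"

lemma scaleC_op_apply: "(c *\<^sub>O T) x = c *\<^sub>C T x"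
  by (simp add: scaleC_op_def bounded_linear_Blinfun_apply bounded_linear_scaleC)

global_interpretation op: vector_space scaleC_op
  by unfold_locales
     (auto intro!: blinfun_eqI ell2_eqI
       simp: scaleC_op_apply blinfun.bilinear_simps coord_plus coord_scaleC algebra_simps)

definition op_power :: "op \<Rightarrow> nat \<Rightarrow> op" where
  "op_power T n = (((o\<^sub>L) T) ^^ n) id_blinfun"

text \<open>Adjoint with respect to the complex inner product.  The description is unspecified if no adjoint
  exists; for the shift it does (lemma \<open>cinner_shift_adjoint\<close>).\<close>

definition op_adjoint :: "op \<Rightarrow> op" where
  "op_adjoint T = (THE S :: op. \<forall>x y. cinner (S x) y = cinner x (T y))"

definition lie_bracket :: "op \<Rightarrow> op \<Rightarrow> op" where
  "lie_bracket X Y = (X o\<^sub>L Y) - (Y o\<^sub>L X)"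

text \<open>The shift is given in coordinates; on the basis it acts by \<open>shift (ket n) = ket (Suc n)\<close>
  (lemma \<open>shift_ket\<close>).\<close>

definition shift :: op where
  "shift = Blinfun (\<lambda>x. Abs_ell2 (\<lambda>n. case n of 0 \<Rightarrow> 0 | Suc k \<Rightarrow> coord x k))"

definition vacuum_proj :: op where
  "vacuum_proj = Blinfun (\<lambda>x. cinner (ket 0) x *\<^sub>C ket 0)"

definition shift_algebra :: "op set" where
  "shift_algebra = op.span
     ({op_power shift a o\<^sub>L vacuum_proj o\<^sub>L op_power (op_adjoint shift) b | a b. True}
      \<union> {op_power shift n | n. True})"


section \<open>Chevalley--Eilenberg cochains\<close>

text \<open>The brackets below stay in \<open>shift_algebra\<close> by lemma \<open>shift_algebra_lie_bracket\<close>, so the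
  differential makes sense for cochains on that Lie algebra.\<close>

definition cbilinear_on :: "op set \<Rightarrow> (op \<Rightarrow> op \<Rightarrow> complex) \<Rightarrow> bool" where
  "cbilinear_on L \<omega> \<longleftrightarrow> (\<forall>X\<in>L. \<forall>Y\<in>L. \<forall>Z\<in>L. \<forall>c.
     \<omega> (X + Y) Z = \<omega> X Z + \<omega> Y Z \<and> \<omega> (c *\<^sub>O X) Z = c * \<omega> X Z \<and>
     \<omega> Z (X + Y) = \<omega> Z X + \<omega> Z Y \<and> \<omega> Z (c *\<^sub>O X) = c * \<omega> Z X)"

definition ce_differential :: "(op \<Rightarrow> op \<Rightarrow> complex) \<Rightarrow> op \<Rightarrow> op \<Rightarrow> op \<Rightarrow> complex" where
  "ce_differential \<omega> X Y Z =
     \<omega> (lie_bracket X Y) Z + \<omega> (lie_bracket Y Z) X + \<omega> (lie_bracket Z X) Y"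

definition diag_cocycle :: "nat \<Rightarrow> op \<Rightarrow> op \<Rightarrow> complex" where
  "diag_cocycle j X Y = cinner (ket j) (lie_bracket X Y (ket j))"


section \<open>Basic facts on the operators\<close>

lemma square_summable_shift:
  "square_summable (\<lambda>n. case n of 0 \<Rightarrow> 0 | Suc k \<Rightarrow> coord x k)"
  using square_summable_coord[of x] unfolding square_summable_def
  by (subst summable_Suc_iff[symmetric]) simp

lemma shift_apply: "coord (shift x) n = (case n of 0 \<Rightarrow> 0 | Suc k \<Rightarrow> coord x k)"
proof -
  let ?S = "\<lambda>x. Abs_ell2 (\<lambda>n. case n of 0 \<Rightarrow> 0 | Suc k \<Rightarrow> coord x k)"
  have c: "coord (?S x) n = (case n of 0 \<Rightarrow> 0 | Suc k \<Rightarrow> coord x k)" for x n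
    by (simp add: coord_Abs square_summable_shift)
  have "norm (?S x) = norm x" for x
  proof -
    have "summable (\<lambda>n. (cmod (coord (?S x) n))\<^sup>2)"
      using cinner_self_sums sums_summable by blast
    from suminf_split_head[OF this] show ?thesis
      by (simp add: norm_ell2 c)
  qed
  then have "bounded_linear ?S"
    by (intro bounded_linear_intro[where K = 1])
       (auto intro!: ell2_eqI simp: c coord_plus coord_scaleR split: nat.split)
  then show ?thesis by (simp add: shift_def bounded_linear_Blinfun_apply c)
qed

lemma shift_ket: "shift (ket n) = ket (Suc n)"
  by (rule ell2_eqI) (simp add: shift_apply coord_ket split: nat.split)

lemma vacuum_proj_apply: "vacuum_proj x = cinner (ket 0) x *\<^sub>C ket 0"
proof -
  have "bounded_linear (\<lambda>x. cinner (ket 0) x *\<^sub>C ket 0)"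
  proof (rule bounded_linear_intro[where K = 1])
    show "norm (cinner (ket 0) x *\<^sub>C ket 0) \<le> norm x * 1" for x
      using cinner_Cauchy_Schwarz[of "ket 0" x] by (simp add: norm_scaleC norm_ket)
  qed (auto intro!: ell2_eqI
        simp: cinner_ket coord_plus coord_scaleR coord_scaleC algebra_simps)
  then show ?thesis by (simp add: vacuum_proj_def bounded_linear_Blinfun_apply)
qed

lemma op_adjoint_unique:
  fixes S T :: op
  assumes "\<And>x y. cinner (S x) y = cinner x (T y)"
  shows "op_adjoint T = S"
  unfolding op_adjoint_def
proof (rule the_equality)
  show "\<forall>x y. cinner (S x) y = cinner x (T y)" using assms by blast
  fix S' :: op assume "\<forall>x y. cinner (S' x) y = cinner x (T y)"
  then show "S' = S" using assms by (intro blinfun_eqI cinner_ext) simp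
qed

lemma shift_adjoint:
  shows cinner_shift_adjoint: "cinner (op_adjoint shift x) y = cinner x (shift y)"
    and shift_adjoint_apply: "coord (op_adjoint shift x) n = coord x (Suc n)"
proof -
  define B where "B x = Abs_ell2 (\<lambda>n. coord x (Suc n))" for x
  have c: "coord (B x) n = coord x (Suc n)" for x n
    unfolding B_def using square_summable_coord[of x]
    by (subst coord_Abs) (auto simp: square_summable_def summable_Suc_iff
        intro: summable_Suc_iff[THEN iffD2])
  have "norm (B x) \<le> norm x" for x
  proof -
    have "summable (\<lambda>n. (cmod (coord x n))\<^sup>2)"
      using cinner_self_sums sums_summable by blast
    from suminf_split_head[OF this] show ?thesis
      by (simp add: norm_ell2 c)
  qed
  then have lin: "bounded_linear B"
    by (intro bounded_linear_intro[where K = 1])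
       (auto intro!: ell2_eqI simp: c coord_plus coord_scaleR)
  have "cinner (Blinfun B x) y = cinner x (shift y)" for x y
    using suminf_split_head[OF summable_cinner[of x "shift y"]]
    by (simp add: cinner_def bounded_linear_Blinfun_apply[OF lin] c shift_apply)
  then have adj: "op_adjoint shift = Blinfun B" by (rule op_adjoint_unique)
  show "cinner (op_adjoint shift x) y = cinner x (shift y)"
    unfolding adj by fact
  show "coord (op_adjoint shift x) n = coord x (Suc n)"
    unfolding adj by (simp add: bounded_linear_Blinfun_apply[OF lin] c)
qed

lemma coord_shift_power:
  "coord (op_power shift a x) n = (if n < a then 0 else coord x (n - a))"
  by (induction a arbitrary: n) (auto simp: op_power_def shift_apply split: nat.split)

lemma coord_adjoint_power: "coord (op_power (op_adjoint shift) b x) n = coord x (n + b)"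
  by (induction b arbitrary: n) (auto simp: op_power_def shift_adjoint_apply)

lemma coord_vacuum_proj: "coord (vacuum_proj x) n = (if n = 0 then coord x 0 else 0)"
  by (simp add: vacuum_proj_apply coord_scaleC coord_ket cinner_ket)

lemma clinear_op_iff: "clinear_op T \<longleftrightarrow> (\<forall>c x n. coord (T (c *\<^sub>C x)) n = c * coord (T x) n)"
  unfolding clinear_op_def by (metis coord_scaleC ell2_eqI)

lemma shift_algebra_clinear:
  assumes "X \<in> shift_algebra"
  shows "clinear_op X"
  using assms unfolding shift_algebra_def
proof (induction rule: op.span_induct_alt)
  case base
  then show ?case by (simp add: clinear_op_iff coord_zero)
next
  case (step c T S)
  from step(1) have "clinear_op T"
    by (auto simp: clinear_op_iff coord_scaleC coord_shift_power coord_adjoint_power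
        coord_vacuum_proj)
  with step(2) show ?case
    by (simp add: clinear_op_iff blinfun.add_left coord_plus scaleC_op_apply coord_scaleC
        algebra_simps)
qed

lemma shift_algebra_compose:
  assumes "X \<in> shift_algebra" "Y \<in> shift_algebra"
  shows "X o\<^sub>L Y \<in> shift_algebra"
proof -
  let ?P = "\<lambda>a b. op_power shift a o\<^sub>L vacuum_proj o\<^sub>L op_power (op_adjoint shift) b"
  let ?U = "op_power shift"
  let ?G = "{?P a b | a b. True} \<union> {?U n | n. True}"
  have P: "?P a b \<in> shift_algebra" and U: "?U n \<in> shift_algebra" for a b n
    unfolding shift_algebra_def by (auto intro!: op.span_base)
  note Z = op.span_zero[of ?G, folded shift_algebra_def]
  note simps = coord_shift_power coord_adjoint_power coord_vacuum_proj coord_zero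
  have gen: "T o\<^sub>L S \<in> shift_algebra" if T: "T \<in> ?G" and S: "S \<in> ?G" for T S
  proof -
    consider (PP) a b c d where "T = ?P a b" "S = ?P c d"
      | (PU) a b n where "T = ?P a b" "S = ?U n"
      | (UP) n a b where "T = ?U n" "S = ?P a b"
      | (UU) n m where "T = ?U n" "S = ?U m"
      using T S by blast
    then show ?thesis
    proof cases
      case PP
      have "T o\<^sub>L S = (if b = c then ?P a d else 0)"
        unfolding PP by (intro blinfun_eqI ell2_eqI) (auto simp: simps)
      then show ?thesis using P Z by simp
    next
      case PU
      have "T o\<^sub>L S = (if n \<le> b then ?P a (b - n) else 0)"
        unfolding PU by (intro blinfun_eqI ell2_eqI) (auto simp: simps)
      then show ?thesis using P Z by simp
    next
      case UP
      have "T o\<^sub>L S = ?P (n + a) b"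
        unfolding UP by (intro blinfun_eqI ell2_eqI) (auto simp: simps)
      then show ?thesis using P by simp
    next
      case UU
      have "T o\<^sub>L S = ?U (n + m)"
        unfolding UU by (intro blinfun_eqI ell2_eqI) (auto simp: simps)
      then show ?thesis using U by simp
    qed
  qed
  note add = op.span_add[of _ ?G, folded shift_algebra_def]
  note scale = op.span_scale[of _ ?G, folded shift_algebra_def]
  have left: "T o\<^sub>L Y \<in> shift_algebra" if T: "T \<in> ?G" for T
    using assms(2)[unfolded shift_algebra_def]
  proof (induction rule: op.span_induct_alt)
    case base
    have "T o\<^sub>L 0 = 0" by (rule blinfun_eqI) (simp add: blinfun.zero_right)
    then show ?case using Z by simp
  next
    case (step c S R)
    have "clinear_op T" using T shift_algebra_clinear P U by blast
    then have "T o\<^sub>L (c *\<^sub>O S + R) = c *\<^sub>O (T o\<^sub>L S) + (T o\<^sub>L R)"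
      by (intro blinfun_eqI)
         (simp add: clinear_op_def blinfun.add_left blinfun.add_right scaleC_op_apply)
    then show ?case using add scale gen[OF T step(1)] step(2) by simp
  qed
  show ?thesis
    using assms(1)[unfolded shift_algebra_def]
  proof (induction rule: op.span_induct_alt)
    case base
    have "0 o\<^sub>L Y = 0" by (rule blinfun_eqI) simp
    then show ?case using Z by simp
  next
    case (step c S R)
    have "(c *\<^sub>O S + R) o\<^sub>L Y = c *\<^sub>O (S o\<^sub>L Y) + (R o\<^sub>L Y)"
      by (intro blinfun_eqI) (simp add: blinfun.add_left scaleC_op_apply)
    then show ?case using add scale left[OF step(1)] step(2) by simp
  qed
qed

lemma lie_bracket_apply: "lie_bracket X Y x = X (Y x) - Y (X x)"
  by (simp add: lie_bracket_def blinfun.diff_left)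

lemma shift_algebra_lie_bracket:
  assumes "X \<in> shift_algebra" "Y \<in> shift_algebra"
  shows "lie_bracket X Y \<in> shift_algebra"
  using op.span_diff[OF shift_algebra_compose[OF assms, unfolded shift_algebra_def]
      shift_algebra_compose[OF assms(2,1), unfolded shift_algebra_def]]
  unfolding lie_bracket_def shift_algebra_def .

end

theory Submission
  imports Defs
begin

text \<open>The form is the composite of the commutator with the linear functional T -> <e_j, T
  e_j>, so up to sign it is a coboundary. Antisymmetry comes from the bracket, and the differential
  is the functional applied to the Jacobi sum (\<open>lie_bracket_jacobi\<close>). As e_j is a unit
  vector, Cauchy-Schwarz bounds the functional by the operator norm; submultiplicativity bounds the
  commutator. Membership in \<open>shift_algebra\<close> supplies complex linearity.\<close>

lemma diag_cocycle_coord: "diag_cocycle j X Y = coord (lie_bracket X Y (ket j)) j"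
  by (simp add: diag_cocycle_def cinner_ket)

text \<open>Pairing with the unit vector \<open>ket n\<close> has bound 1; this feeds the continuity
  proof.\<close>

lemma bounded_linear_coord: "bounded_linear (\<lambda>x. coord x n)"
  by (rule bounded_linear_intro[where K = 1])
     (use cinner_Cauchy_Schwarz[of "ket n"] in
       \<open>auto simp: coord_plus coord_scaleR scaleR_conv_of_real cinner_ket norm_ket\<close>)

lemma norm_lie_bracket_le: "norm (lie_bracket X Y) \<le> 2 * norm X * norm Y"
proof -
  have "norm (lie_bracket X Y) \<le> norm (X o\<^sub>L Y) + norm (Y o\<^sub>L X)"
    unfolding lie_bracket_def by (rule norm_triangle_ineq4)
  then show ?thesis
    using norm_blinfun_compose[of X Y] norm_blinfun_compose[of Y X]
    by (simp add: mult.commute[of "norm Y"])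
qed

text \<open>After expansion the twelve triple products cancel in pairs; additivity of the operators
  suffices.\<close>

lemma lie_bracket_jacobi:
  "lie_bracket (lie_bracket X Y) Z + lie_bracket (lie_bracket Y Z) X
    + lie_bracket (lie_bracket Z X) Y = 0"
  by (rule blinfun_eqI)
     (simp add: lie_bracket_apply blinfun.add_left blinfun.diff_right algebra_simps)

lemma diag_cocycle_antisym: "diag_cocycle j X Y = - diag_cocycle j Y X"
  by (simp add: diag_cocycle_coord lie_bracket_apply coord_minus)

lemma ce_differential_diag_cocycle: "ce_differential (diag_cocycle j) X Y Z = 0"
proof -
  \<comment> \<open>Additivity of the functional gathers the three terms into one Jacobi
    sum.\<close>
  have "ce_differential (diag_cocycle j) X Y Z
    = coord ((lie_bracket (lie_bracket X Y) Z + lie_bracket (lie_bracket Y Z) X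
        + lie_bracket (lie_bracket Z X) Y) (ket j)) j"
    by (simp add: ce_differential_def diag_cocycle_coord blinfun.add_left coord_plus)
  then show ?thesis
    by (simp add: lie_bracket_jacobi coord_zero)
qed

lemma cmod_diag_cocycle_le: "cmod (diag_cocycle j X Y) \<le> norm (lie_bracket X Y)"
proof -
  have "cmod (diag_cocycle j X Y) \<le> norm (lie_bracket X Y (ket j))"
    using cinner_Cauchy_Schwarz[of "ket j" "lie_bracket X Y (ket j)"]
    by (simp add: diag_cocycle_def norm_ket)
  also have "\<dots> \<le> norm (lie_bracket X Y)"
    using norm_blinfun[of "lie_bracket X Y" "ket j"] by (simp add: norm_ket)
  finally show ?thesis .
qed

text \<open>Applying an operator to a vector is jointly continuous in both, hence so is each of X(Y
  e_j) and Y(X e_j).\<close>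

lemma continuous_on_diag_cocycle: "continuous_on S (\<lambda>(X, Y). diag_cocycle j X Y)"
  unfolding diag_cocycle_coord lie_bracket_apply case_prod_beta
  by (intro bounded_linear.continuous_on[OF bounded_linear_coord] continuous_intros)

text \<open>Type \<open>op\<close> guarantees real linearity only. Scaling X by c produces a term
  Y(c X e_j), so Y must commute with complex scalars; hence the assumption.\<close>

lemma cbilinear_on_diag_cocycle:
  assumes "\<And>X. X \<in> L \<Longrightarrow> clinear_op X"
  shows "cbilinear_on L (diag_cocycle j)"
  using assms
  by (auto simp: cbilinear_on_def diag_cocycle_coord lie_bracket_apply clinear_op_def
      scaleC_op_apply blinfun.add_left blinfun.add_right coord_minus coord_plus coord_scaleC
      algebra_simps)

theorem proposition3p2:
  fixes j :: nat
  shows "cbilinear_on shift_algebra (diag_cocycle j)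
    \<and> continuous_on (shift_algebra \<times> shift_algebra) (\<lambda>(X, Y). diag_cocycle j X Y)
    \<and> (\<forall>X\<in>shift_algebra. \<forall>Y\<in>shift_algebra. diag_cocycle j X Y = - diag_cocycle j Y X)
    \<and> (\<forall>X\<in>shift_algebra. \<forall>Y\<in>shift_algebra. \<forall>Z\<in>shift_algebra.
         ce_differential (diag_cocycle j) X Y Z = 0)
    \<and> (\<forall>X\<in>shift_algebra. \<forall>Y\<in>shift_algebra.
         cmod (diag_cocycle j X Y) \<le> norm (lie_bracket X Y)
         \<and> norm (lie_bracket X Y) \<le> 2 * norm X * norm Y)"
  by (intro conjI ballI cbilinear_on_diag_cocycle shift_algebra_clinear continuous_on_diag_cocycle
      diag_cocycle_antisym ce_differential_diag_cocycle cmod_diag_cocycle_le norm_lie_bracket_le)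

end
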